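(* For all integers $p$, $q$ and $r$, the following sixteen identities hold: \[F_{p+q+r}=F_{q-1}F_rF_{p-1}+(F_{q+1}F_r+F_{q-1}F_{r-1})F_p+F_qF_{r+1}F_{p+1},\] \[F_{p+q+r}=F_{p-1}F_rF_{q-1}+(F_{p+1}F_r+F_{p-1}F_{r-1})F_q+F_pF_{r+1}F_{q+1},\] \[F_{p+q+r}=F_{q-1}F_pF_{r-1}+(F_{q+1}F_p+F_{q-1}F_{p-1})F_r+F_qF_{p+1}F_{r+1},\] \[F_{p+q+r}=F_{r-1}F_qF_{p-1}+(F_{r+1}F_q+F_{r-1}F_{q-1})F_p+F_rF_{q+1}F_{p+1},\] \[L_{p+q+r}=F_{q-1}F_rL_{p-1}+(F_{q+1}F_r+F_{q-1}F_{r-1})L_p+F_qF_{r+1}L_{p+1},\] \[L_{p+q+r}=F_{p-1}F_rL_{q-1}+(F_{p+1}F_r+F_{p-1}F_{r-1})L_q+F_pF_{r+1}L_{q+1},\] \[L_{p+q+r}=F_{q-1}F_pL_{r-1}+(F_{q+1}F_p+F_{q-1}F_{p-1})L_r+F_qF_{p+1}L_{r+1},\] \[L_{p+q+r}=F_{r-1}F_qL_{p-1}+(F_{r+1}F_q+F_{r-1}F_{q-1})L_p+F_rF_{q+1}L_{p+1},\] \[5F_{p+q+r}=L_{q-1}L_rF_{p-1}+(L_{q+1}L_r+L_{q-1}L_{r-1})F_p+L_qL_{r+1}F_{p+1},\] \[5F_{p+q+r}=L_{p-1}L_rF_{q-1}+(L_{p+1}L_r+L_{p-1}L_{r-1})F_q+L_pL_{r+1}F_{q+1},\]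 \[5F_{p+q+r}=L_{q-1}L_pF_{r-1}+(L_{q+1}L_p+L_{q-1}L_{p-1})F_r+L_qL_{p+1}F_{r+1},\] \[5F_{p+q+r}=L_{r-1}L_qF_{p-1}+(L_{r+1}L_q+L_{r-1}L_{q-1})F_p+L_rL_{q+1}F_{p+1},\] \[5L_{p+q+r}=L_{q-1}L_rL_{p-1}+(L_{q+1}L_r+L_{q-1}L_{r-1})L_p+L_qL_{r+1}L_{p+1},\] \[5L_{p+q+r}=L_{p-1}L_rL_{q-1}+(L_{p+1}L_r+L_{p-1}L_{r-1})L_q+L_pL_{r+1}L_{q+1},\] \[5L_{p+q+r}=L_{q-1}L_pL_{r-1}+(L_{q+1}L_p+L_{q-1}L_{p-1})L_r+L_qL_{p+1}L_{r+1},\] \[5L_{p+q+r}=L_{r-1}L_qL_{p-1}+(L_{r+1}L_q+L_{r-1}L_{q-1})L_p+L_rL_{q+1}L_{p+1}.\]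
   Context: The Fibonacci numbers $F_n$ and Lucas numbers $L_n$ are defined for all integers $n$ by $F_0=0$, $F_1=1$, $F_n=F_{n-1}+F_{n-2}$ for $n\ge 2$; $L_0=2$, $L_1=1$, $L_n=L_{n-1}+L_{n-2}$ for $n\ge 2$; and $F_{-n}=(-1)^{n-1}F_n$, $L_{-n}=(-1)^nL_n$. *)

theory Defs
  imports "HOL-Number_Theory.Fib"
begin

fun lucas :: "nat \<Rightarrow> nat" where
  "lucas 0 = 2"
| "lucas (Suc 0) = 1"
| "lucas (Suc (Suc n)) = lucas (Suc n) + lucas n"

definition F :: "int \<Rightarrow> int" where
  "F n = (if 0 \<le> n then int (fib (nat n))
          else (- 1) ^ nat (- n - 1) * int (fib (nat (- n))))"

definition L :: "int \<Rightarrow> int" where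
  "L n = (if 0 \<le> n then int (lucas (nat n))
          else (- 1) ^ nat (- n) * int (lucas (nat (- n))))"

lemma F_initial: "F 0 = 0" "F 1 = 1"
  by (simp_all add: F_def)

lemma L_initial: "L 0 = 2" "L 1 = 1"
  by (simp_all add: L_def)

lemma F_rec: "F n = F (n - 1) + F (n - 2)" if "n \<ge> 2"
proof -
  define k where "k = nat (n - 2)"
  have n: "n = int k + 2" using that by (simp add: k_def)
  have "nat (int k + 2) = Suc (Suc k)" "nat (1 + int k) = Suc k" by simp_all
  then show ?thesis by (simp add: F_def n)
qed

lemma L_rec: "L n = L (n - 1) + L (n - 2)" if "n \<ge> 2"
proof -
  define k where "k = nat (n - 2)"
  have n: "n = int k + 2" using that by (simp add: k_def)
  have "nat (int k + 2) = Suc (Suc k)" "nat (1 + int k) = Suc k" by simp_all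
  then show ?thesis by (simp add: L_def n)
qed

lemma F_minus: "F (- n) = (- 1) ^ nat (n - 1) * F n" if "n > 0"
  using that by (simp add: F_def)

lemma L_minus: "L (- n) = (- 1) ^ nat n * L n" if "n \<ge> 0"
  using that by (cases "n = 0") (simp_all add: L_def)

end

theory Submission
  imports Defs
begin

text \<open>
  Both \<^const>\<open>F\<close> and \<^const>\<open>L\<close> satisfy the recurrence \<open>G (n + 1) = G n + G (n - 1)\<close> at every
  integer \<open>n\<close>, and a solution of this recurrence is determined by its values at 0 and 1. Hence every
  solution obeys the addition formula \<open>G (m + n) = F m * G (n + 1) + F (m - 1) * G n\<close>
  (\<open>fib_like_add\<close>).

  In the identities whose last factor \<open>G\<close> carries the index \<open>p\<close>, replace \<open>G (p - 1)\<close> by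
  \<open>G (p + 1) - G p\<close>. When the other two factors are Fibonacci numbers, the coefficients of
  \<open>G (p + 1)\<close> and \<open>G p\<close> then become \<open>F (q + r)\<close> and \<open>F (q + r - 1)\<close>, so that the identity is the
  addition formula for \<open>m = q + r\<close> and \<open>n = p\<close>. When they are Lucas numbers, the coefficients
  become \<open>5 * F (q + r)\<close> and \<open>5 * F (q + r - 1)\<close>, because of
  \<open>L m * L (n + 1) + L (m - 1) * L n = 5 * F (m + n)\<close> (\<open>L_mult_add\<close>). There are thus only two
  identities to prove, \<open>fib_like_add3_F\<close> and \<open>fib_like_add3_L\<close>, each valid for an arbitrary solution
  \<open>G\<close>; the sixteen are obtained by taking \<open>G\<close> to be \<^const>\<open>F\<close> or \<^const>\<open>L\<close> and permuting
  \<open>p\<close>, \<open>q\<close> and \<open>r\<close>.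
\<close>

text \<open>The two-sided integer sequences that satisfy the Fibonacci recurrence, with arbitrary initial
  values.\<close>

definition fib_like :: "(int \<Rightarrow> int) \<Rightarrow> bool" where
  "fib_like G \<longleftrightarrow> (\<forall>n. G (n + 1) = G n + G (n - 1))"

lemma fib_likeD: "G (n + 1) = G n + G (n - 1)" if "fib_like G"
  using that by (simp add: fib_like_def)

lemma fib_like_pred: "G (n - 1) = G (n + 1) - G n" if "fib_like G"
  using fib_likeD[OF that, of n] by simp

lemma fib_like_shift: "fib_like (\<lambda>n. G (n + c))" if "fib_like G"
  unfolding fib_like_def
proof
  fix n
  show "G (n + 1 + c) = G (n + c) + G (n - 1 + c)"
    using fib_likeD[OF that, of "n + c"] by (simp add: algebra_simps)
qed

lemma fib_like_lincomb: "fib_like (\<lambda>n. a * G n + b * H n)" if "fib_like G" "fib_like H"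
  using that by (simp add: fib_like_def algebra_simps)

lemma fib_like_unique:
  assumes G: "fib_like G" and H: "fib_like H" and "G 0 = H 0" "G 1 = H 1"
  shows "G n = H n"
proof -
  \<comment> \<open>The recurrence has order two, so two consecutive values have to be carried along.\<close>
  have "G n = H n \<and> G (n + 1) = H (n + 1)"
  proof (induction n rule: int_induct[where k = 0])
    case base
    then show ?case using assms by simp
  next
    case (step1 i)
    then show ?case
      using fib_likeD[OF G, of "i + 1"] fib_likeD[OF H, of "i + 1"] by simp
  next
    case (step2 i)
    then show ?case using fib_like_pred[OF G, of i] fib_like_pred[OF H, of i] by simp
  qed
  then show ?thesis ..
qed

lemma F_uminus_int: "F (- int k) = (- 1) ^ Suc k * int (fib k)"
  by (cases k) (simp_all add: F_def nat_add_distrib)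

lemma L_uminus_int: "L (- int k) = (- 1) ^ k * int (lucas k)"
  by (cases k) (simp_all add: L_def nat_add_distrib)

lemma fib_like_F: "fib_like F"
  unfolding fib_like_def
proof
  fix n :: int
  consider "n \<ge> 1" | "n = 0" | "n \<le> - 1" by linarith
  then show "F (n + 1) = F n + F (n - 1)"
  proof cases
    case 1
    then show ?thesis using F_rec[of "n + 1"] by simp
  next
    case 2
    then show ?thesis by (simp add: F_def)
  next
    case 3
    define k where "k = nat (- n - 1)"
    have n: "n = - int k - 1" using 3 by (simp add: k_def)
    have "n + 1 = - int k" "n = - int (Suc k)" "n - 1 = - int (Suc (Suc k))"
      by (simp_all add: n)
    then show ?thesis
      by (simp only: F_uminus_int) (simp add: algebra_simps)
  qed
qed

lemma fib_like_L: "fib_like L"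
  unfolding fib_like_def
proof
  fix n :: int
  consider "n \<ge> 1" | "n = 0" | "n \<le> - 1" by linarith
  then show "L (n + 1) = L n + L (n - 1)"
  proof cases
    case 1
    then show ?thesis using L_rec[of "n + 1"] by simp
  next
    case 2
    then show ?thesis by (simp add: L_def)
  next
    case 3
    define k where "k = nat (- n - 1)"
    have n: "n = - int k - 1" using 3 by (simp add: k_def)
    have "n + 1 = - int k" "n = - int (Suc k)" "n - 1 = - int (Suc (Suc k))"
      by (simp_all add: n)
    then show ?thesis
      by (simp only: L_uminus_int) (simp add: algebra_simps)
  qed
qed

lemma fib_like_add:
  assumes "fib_like G"
  shows "G (m + n) = F m * G (n + 1) + F (m - 1) * G n"
proof -
  define H where "H m = G (n + 1) * F m + G n * F (m + - 1)" for m
  have "fib_like H"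
    unfolding H_def by (rule fib_like_lincomb[OF fib_like_F fib_like_shift[OF fib_like_F]])
  moreover have "G (0 + n) = H 0" "G (1 + n) = H 1"
    by (simp_all add: H_def F_def add.commute[of 1 n])
  ultimately have "G (m + n) = H m"
    by (rule fib_like_unique[where G = "\<lambda>m. G (m + n)", OF fib_like_shift[OF assms]])
  then show ?thesis by (simp add: H_def mult.commute)
qed

lemma L_eq_F: "L n = F (n + 1) + F (n - 1)"
proof -
  define H where "H n = 1 * F (n + 1) + 1 * F (n + - 1)" for n
  have "fib_like H"
    unfolding H_def
    by (rule fib_like_lincomb[OF fib_like_shift[OF fib_like_F] fib_like_shift[OF fib_like_F]])
  moreover have "L 0 = H 0" "L 1 = H 1"
    by (simp_all add: H_def F_def L_def numeral_2_eq_2)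
  ultimately have "L n = H n"
    by (rule fib_like_unique[OF fib_like_L])
  then show ?thesis by (simp add: H_def)
qed

lemma five_F_eq_L: "5 * F n = L (n + 1) + L (n - 1)"
  using fib_likeD[OF fib_like_F, of "n + 1"] fib_likeD[OF fib_like_F, of n]
    fib_likeD[OF fib_like_F, of "n - 1"]
  by (simp add: L_eq_F)

text \<open>The Lucas analogue of the addition formula: expanding \<open>L m\<close> and \<open>L (m - 1)\<close> by
  \<open>L_eq_F\<close> turns the left-hand side into \<open>L (m + n + 1) + L (m + n - 1)\<close>.\<close>

lemma L_mult_add: "L m * L (n + 1) + L (m - 1) * L n = 5 * F (m + n)"
proof -
  have "L (m + n + 1) = F (m + 1) * L (n + 1) + F m * L n"
    using fib_like_add[OF fib_like_L, of "m + 1" n] by (simp add: algebra_simps)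
  moreover have "L (m + n - 1) = F (m - 1) * L (n + 1) + F (m - 2) * L n"
    using fib_like_add[OF fib_like_L, of "m - 1" n] by (simp add: algebra_simps)
  moreover have "L m = F (m + 1) + F (m - 1)" "L (m - 1) = F m + F (m - 2)"
    using L_eq_F[of m] L_eq_F[of "m - 1"] by simp_all
  ultimately show ?thesis
    unfolding five_F_eq_L by (simp only: algebra_simps)
qed

lemma fib_like_add3_F:
  assumes "fib_like G"
  shows "G (p + q + r) = F (q - 1) * F r * G (p - 1)
    + (F (q + 1) * F r + F (q - 1) * F (r - 1)) * G p + F q * F (r + 1) * G (p + 1)"
proof -
  have "G (p + q + r) = F (q + r) * G (p + 1) + F (q + r - 1) * G p"
    using fib_like_add[OF assms, of "q + r" p] by (simp add: algebra_simps)
  moreover have "F (q + r) = F q * F (r + 1) + F (q - 1) * F r"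
    by (rule fib_like_add[OF fib_like_F])
  moreover have "F (q + r - 1) = F q * F r + F (q - 1) * F (r - 1)"
    using fib_like_add[OF fib_like_F, of q "r - 1"] by (simp add: algebra_simps)
  ultimately have "G (p + q + r) = (F q * F (r + 1) + F (q - 1) * F r) * G (p + 1)
      + (F q * F r + F (q - 1) * F (r - 1)) * G p"
    by simp
  then show ?thesis
    unfolding fib_like_pred[OF assms, of p] fib_likeD[OF fib_like_F, of q]
    by (simp only: algebra_simps)
qed

lemma fib_like_add3_L:
  assumes "fib_like G"
  shows "5 * G (p + q + r) = L (q - 1) * L r * G (p - 1)
    + (L (q + 1) * L r + L (q - 1) * L (r - 1)) * G p + L q * L (r + 1) * G (p + 1)"
proof -
  have "5 * G (p + q + r) = 5 * F (q + r) * G (p + 1) + 5 * F (q + r - 1) * G p"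
    using fib_like_add[OF assms, of "q + r" p] by (simp add: algebra_simps)
  moreover have "5 * F (q + r) = L q * L (r + 1) + L (q - 1) * L r"
    by (rule L_mult_add[symmetric])
  moreover have "5 * F (q + r - 1) = L q * L r + L (q - 1) * L (r - 1)"
    using L_mult_add[of q "r - 1"] by (simp add: algebra_simps)
  ultimately have "5 * G (p + q + r) = (L q * L (r + 1) + L (q - 1) * L r) * G (p + 1)
      + (L q * L r + L (q - 1) * L (r - 1)) * G p"
    by simp
  then show ?thesis
    unfolding fib_like_pred[OF assms, of p] fib_likeD[OF fib_like_L, of q]
    by (simp only: algebra_simps)
qed

theorem theorem1:
  fixes p q r :: int
  shows
    "(F (p + q + r) =
        F (q - 1) * F r * F (p - 1) + (F (q + 1) * F r + F (q - 1) * F (r - 1)) * F p + F q * F (r + 1) * F (p + 1)) \<and>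
     (F (p + q + r) =
        F (p - 1) * F r * F (q - 1) + (F (p + 1) * F r + F (p - 1) * F (r - 1)) * F q + F p * F (r + 1) * F (q + 1)) \<and>
     (F (p + q + r) =
        F (q - 1) * F p * F (r - 1) + (F (q + 1) * F p + F (q - 1) * F (p - 1)) * F r + F q * F (p + 1) * F (r + 1)) \<and>
     (F (p + q + r) =
        F (r - 1) * F q * F (p - 1) + (F (r + 1) * F q + F (r - 1) * F (q - 1)) * F p + F r * F (q + 1) * F (p + 1)) \<and>
     (L (p + q + r) =
        F (q - 1) * F r * L (p - 1) + (F (q + 1) * F r + F (q - 1) * F (r - 1)) * L p + F q * F (r + 1) * L (p + 1)) \<and>
     (L (p + q + r) =
        F (p - 1) * F r * L (q - 1) + (F (p + 1) * F r + F (p - 1) * F (r - 1)) * L q + F p * F (r + 1) * L (q + 1)) \<and>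
     (L (p + q + r) =
        F (q - 1) * F p * L (r - 1) + (F (q + 1) * F p + F (q - 1) * F (p - 1)) * L r + F q * F (p + 1) * L (r + 1)) \<and>
     (L (p + q + r) =
        F (r - 1) * F q * L (p - 1) + (F (r + 1) * F q + F (r - 1) * F (q - 1)) * L p + F r * F (q + 1) * L (p + 1)) \<and>
     (5 * F (p + q + r) =
        L (q - 1) * L r * F (p - 1) + (L (q + 1) * L r + L (q - 1) * L (r - 1)) * F p + L q * L (r + 1) * F (p + 1)) \<and>
     (5 * F (p + q + r) =
        L (p - 1) * L r * F (q - 1) + (L (p + 1) * L r + L (p - 1) * L (r - 1)) * F q + L p * L (r + 1) * F (q + 1)) \<and>
     (5 * F (p + q + r) =
        L (q - 1) * L p * F (r - 1) + (L (q + 1) * L p + L (q - 1) * L (p - 1)) * F r + L q * L (p + 1) * F (r + 1)) \<and>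
     (5 * F (p + q + r) =
        L (r - 1) * L q * F (p - 1) + (L (r + 1) * L q + L (r - 1) * L (q - 1)) * F p + L r * L (q + 1) * F (p + 1)) \<and>
     (5 * L (p + q + r) =
        L (q - 1) * L r * L (p - 1) + (L (q + 1) * L r + L (q - 1) * L (r - 1)) * L p + L q * L (r + 1) * L (p + 1)) \<and>
     (5 * L (p + q + r) =
        L (p - 1) * L r * L (q - 1) + (L (p + 1) * L r + L (p - 1) * L (r - 1)) * L q + L p * L (r + 1) * L (q + 1)) \<and>
     (5 * L (p + q + r) =
        L (q - 1) * L p * L (r - 1) + (L (q + 1) * L p + L (q - 1) * L (p - 1)) * L r + L q * L (p + 1) * L (r + 1)) \<and>
     (5 * L (p + q + r) =
        L (r - 1) * L q * L (p - 1) + (L (r + 1) * L q + L (r - 1) * L (q - 1)) * L p + L r * L (q + 1) * L (p + 1))"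
proof -
  \<comment> \<open>Three permutations of the indices rewrite the sum \<open>p + q + r\<close>, which is restored here.\<close>
  have perms: "q + p + r = p + q + r" "r + q + p = p + q + r" "p + r + q = p + q + r"
    by simp_all
  note rules = fib_like_add3_F[OF fib_like_F] fib_like_add3_F[OF fib_like_L]
    fib_like_add3_L[OF fib_like_F] fib_like_add3_L[OF fib_like_L]
  note facts = rules[of p q r] rules[of q p r] rules[of r q p] rules[of p r q]
  show ?thesis
    by (intro conjI facts[unfolded perms])
qed

end
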